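(* Let $n, k, t$ be positive integers with $k \geq t$. Suppose that $\mathcal{F} \subset \binom{[n]}{k}$ is a $t$-intersecting family and that $$n \geq (k-t)(k+t+3)\cdot \left\lfloor\left( \frac{k+t+3}{k+t+1}\right)^{t-1}\right\rfloor.$$ Then $$|\mathcal{D}(\mathcal{F})| \leq \binom{n-t}{k-t}+\binom{n-t}{k-t-1}+\cdots+\binom{n-t}{0}.$$
   Context: $[n]=\{1,2,\ldots,n\}$, and $\binom{[n]}{k}$ denotes the collection of all $k$-element subsets of $[n]$. $|S|$ is the cardinality of a set $S$, and $\lfloor N\rfloor$ is the largest integer less than or equal to $N$. For a positive integer $t$, a family $\mathcal{F}$ of subsets of $[n]$ is called $t$-intersecting if $|F\cap G|\geq t$ for any two members $F,G\in\mathcal{F}$. For a family $\mathcal{F}$ of subsets of $[n]$, $\mathcal{D}(\mathcal{F})=\{F\setminus G: F,G\in\mathcal{F}\}$ is the collection of all setwise differences; $F=G$ is allowed, so $\emptyset\in\mathcal{D}(\mathcal{F})$ whenever $\mathcal{F}\neq\emptyset$. *)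

theory Defs
  imports Complex_Main
begin

definition t_intersecting :: "nat \<Rightarrow> 'a set set \<Rightarrow> bool" where
  "t_intersecting t \<F> \<longleftrightarrow> (\<forall>F\<in>\<F>. \<forall>G\<in>\<F>. t \<le> card (F \<inter> G))"

definition set_differences :: "'a set set \<Rightarrow> 'a set set" where
  "set_differences \<F> = {F - G | F G. F \<in> \<F> \<and> G \<in> \<F>}"

end

theory Submission
  imports Defs "HOL-Analysis.Harmonic_Numbers"
begin

text \<open>
  Put \<open>r = k - t\<close>. If all members of the family share \<open>t\<close> points, the differences avoid these
  points and the bound is immediate. Otherwise it suffices that at least
  \<open>(n - t - 2r) choose r\<close> of the \<open>r\<close>-subsets of \<open>[n]\<close> are contained in no member. Fix a member \<open>H\<close>.
  An \<open>r\<close>-set \<open>A\<close> disjoint from \<open>H\<close> and contained in a member \<open>F\<close> satisfies \<open>F - A = F \<inter> H\<close>, so it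
  determines a class \<open>F - A \<subseteq> H\<close> of size \<open>t\<close>, and disjoint sets \<open>A\<close> have the same class.
  If there is only one class \<open>T\<close>, every such \<open>A\<close> meets any member not containing \<open>T\<close>.
  If \<open>A1\<close> and \<open>A2\<close> have different classes, then no \<open>A\<close> misses both, and the sets missing \<open>A1\<close>
  cross-intersect those missing \<open>A2\<close>, which costs as many sets as there are \<open>r\<close>-sets missing \<open>A1\<close>.
  The remaining estimate between binomial coefficients holds for all \<open>n \<ge> r * (k + t + 3)\<close>.
  For \<open>n\<close> at this bound and \<open>r\<close> large with \<open>y = (r + 2t) / t\<close> fixed, it reads
  \<open>ln y + 3 / y \<ge> 2\<close>, where the left side has its minimum \<open>ln 3 + 1\<close> at \<open>y = 3\<close>.
\<close>

section \<open>Cross-intersecting sets of equal size\<close>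

text \<open>Double counting of disjoint pairs: the disjointness graph on the
  \<open>s\<close>-subsets of \<open>V\<close> is regular of degree \<open>d\<close>, and
  \<open>2 * s \<le> card V\<close> makes \<open>d\<close> positive, so no set of vertices has a
  smaller neighbourhood.\<close>

lemma card_le_card_disjoint_subsets:
  assumes "finite V" and "2 * s \<le> card V"
    and X: "X \<subseteq> {C. C \<subseteq> V \<and> card C = s}"
  shows "card X \<le> card {C. C \<subseteq> V \<and> card C = s \<and> (\<exists>B\<in>X. B \<inter> C = {})}"
    (is "_ \<le> card ?N")
proof -
  define d where "d = (card V - s) choose s"
  have deg: "card {C. C \<subseteq> V \<and> card C = s \<and> B \<inter> C = {}} = d"
    if "B \<subseteq> V" "card B = s" for B
  proof -
    have "{C. C \<subseteq> V \<and> card C = s \<and> B \<inter> C = {}} = {C. C \<subseteq> V - B \<and> card C = s}"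
      by blast
    then show ?thesis
      using that assms(1) by (simp add: n_subsets card_Diff_subset finite_subset d_def)
  qed
  have fin: "finite X" "finite ?N"
    using assms(1) X by (auto intro: finite_subset[of _ "Pow V"])
  have "d * card X = (\<Sum>B\<in>X. d)"
    by simp
  also have "\<dots> = (\<Sum>B\<in>X. card {C\<in>?N. B \<inter> C = {}})"
  proof (rule sum.cong)
    fix B assume "B \<in> X"
    then have "{C\<in>?N. B \<inter> C = {}} = {C. C \<subseteq> V \<and> card C = s \<and> B \<inter> C = {}}"
      by blast
    moreover have "B \<subseteq> V" "card B = s"
      using X \<open>B \<in> X\<close> by auto
    ultimately show "d = card {C\<in>?N. B \<inter> C = {}}"
      by (simp only: deg)
  qed simp
  also have "\<dots> = (\<Sum>C\<in>?N. card {B\<in>X. B \<inter> C = {}})"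
    by (rule sum_multicount_gen) (use fin in auto)
  also have "\<dots> \<le> (\<Sum>C\<in>?N. d)"
  proof (rule sum_mono)
    fix C assume C: "C \<in> ?N"
    have "card {B\<in>X. B \<inter> C = {}} \<le> card {B. B \<subseteq> V \<and> card B = s \<and> C \<inter> B = {}}"
      using X assms(1) by (intro card_mono) (auto intro: finite_subset[of _ "Pow V"])
    then show "card {B\<in>X. B \<inter> C = {}} \<le> d"
      using deg[of C] C by auto
  qed
  finally have "d * card X \<le> d * card ?N"
    by simp
  moreover have "d > 0"
    using assms(2) by (simp add: d_def)
  ultimately show ?thesis
    by simp
qed

text \<open>The bound is the number of all \<open>r\<close>-sets missing \<open>A1\<close>. Those of
  them that lie in \<open>X\<close> are compensated by sets outside \<open>X\<close> that miss
  \<open>A2\<close> and meet \<open>A1\<close>.\<close>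

lemma card_not_in_cross_intersecting_ge:
  assumes "finite W" and "4 * r \<le> card W" and "r > 0"
    and A1: "A1 \<subseteq> W" "card A1 = r" and A2: "A2 \<subseteq> W" "card A2 = r"
    and hit: "\<And>A. A \<in> X \<Longrightarrow> A \<inter> A1 = {} \<Longrightarrow> A \<inter> A2 \<noteq> {}"
    and cross: "\<And>A B. A \<in> X \<Longrightarrow> B \<in> X \<Longrightarrow> A \<inter> A1 = {} \<Longrightarrow> B \<inter> A2 = {} \<Longrightarrow> A \<inter> B \<noteq> {}"
  shows "(card W - r) choose r \<le> card {A. A \<subseteq> W \<and> card A = r \<and> A \<notin> X}"
proof -
  define R where "R = {A. A \<subseteq> W \<and> card A = r}"
  define V where "V = W - (A1 \<union> A2)"
  define P where "P = {A\<in>R. A \<inter> A1 = {}}"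
  \<comment> \<open>Meeting \<open>A1\<close> keeps \<open>Q\<close> disjoint from \<open>P\<close>,
    so that the two counts can be added at the end.\<close>
  define Q where "Q = {A\<in>R. A \<inter> A2 = {} \<and> A \<inter> A1 \<noteq> {}}"
  have finR: "finite R"
    using assms(1) by (simp add: R_def)
  have finA: "finite A1" "finite A2" "finite V"
    using A1 A2 assms(1) by (auto simp: V_def intro: finite_subset)
  have "card (A1 \<union> A2) \<le> 2 * r"
    using card_Un_le[of A1 A2] A1 A2 by simp
  \<comment> \<open>Room for the disjointness count in \<open>V\<close>, which is applied to sets of
    size \<open>s \<le> r\<close>.\<close>
  then have cardV: "2 * r \<le> card V"
    unfolding V_def using A1 A2 assms(1,2) finA by (subst card_Diff_subset) auto
  have "card (A2 - A1) = card (A1 - A2)"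
    using A1 A2 finA by (simp add: card_Diff_subset_Int Int_commute)
  then obtain \<pi> where \<pi>: "bij_betw \<pi> (A2 - A1) (A1 - A2)"
    using finA by (metis finite_Diff finite_same_card_bij)
  \<comment> \<open>Split the sets missing \<open>A1\<close> by their trace \<open>B\<close> on \<open>A2\<close> and compare with the sets missing \<open>A2\<close>
    whose trace on \<open>A1\<close> is \<open>\<pi> ` B\<close>: what remains of them are sets of equal size in \<open>V\<close>.\<close>
  define J where "J = {B. B \<subseteq> A2 - A1 \<and> B \<noteq> {}}"
  have finJ: "finite J"
    using finA by (auto simp: J_def intro: finite_subset[of _ "Pow A2"])
  define Y where "Y B = {A \<in> X \<inter> P. A \<inter> A2 = B}" for B
  define Z where "Z B = {A \<in> Q - X. A \<inter> A1 = \<pi> ` B}" for B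
  have inj_img: "B = B'" if "B \<in> J" "B' \<in> J" "\<pi> ` B = \<pi> ` B'" for B B'
    using that \<pi> unfolding J_def bij_betw_def by (metis (no_types, lifting) inj_on_image_eq_iff mem_Collect_eq)
  have YZ: "card (Y B) \<le> card (Z B)" if B: "B \<in> J" for B
  proof (cases "card B \<le> r")
    case False
    have "Y B = {}"
    proof (rule ccontr)
      assume "Y B \<noteq> {}"
      then obtain A where "A \<in> R" "A \<inter> A2 = B"
        by (auto simp: Y_def P_def)
      then show False
        using False assms(1) by (auto simp: R_def dest: finite_subset intro: card_mono)
    qed
    then show ?thesis by simp
  next
    case True
    define s where "s = r - card B"
    have finB: "finite B" and BA: "B \<subseteq> A2 - A1"
      using B finA by (auto simp: J_def intro: finite_subset)
    have piB: "\<pi> ` B \<subseteq> A1 - A2" "card (\<pi> ` B) = card B"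
      using \<pi> BA by (auto simp: bij_betw_def inj_on_subset intro!: card_image)
    define C where "C = (\<lambda>A. A - B) ` Y B"
    define N where "N = {D. D \<subseteq> V \<and> card D = s \<and> (\<exists>B\<in>C. B \<inter> D = {})}"
    have sub: "C \<subseteq> {D. D \<subseteq> V \<and> card D = s}"
      using finB by (auto simp: C_def Y_def P_def R_def V_def s_def card_Diff_subset)
    have "inj_on (\<lambda>A. A - B) (Y B)"
      by (auto simp: inj_on_def Y_def)
    then have "card (Y B) = card C"
      by (simp add: C_def card_image)
    also have "\<dots> \<le> card N"
      unfolding N_def using finA(3) cardV sub s_def
      by (intro card_le_card_disjoint_subsets) auto
    also have "\<dots> = card ((\<lambda>D. D \<union> \<pi> ` B) ` N)"
    proof (intro card_image[symmetric] inj_onI)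
      fix D E assume "D \<in> N" "E \<in> N" "D \<union> \<pi> ` B = E \<union> \<pi> ` B"
      moreover have "D \<inter> \<pi> ` B = {}" "E \<inter> \<pi> ` B = {}"
        using piB(1) \<open>D \<in> N\<close> \<open>E \<in> N\<close> by (auto simp: N_def V_def)
      ultimately show "D = E"
        by blast
    qed
    also have "\<dots> \<le> card (Z B)"
    proof (rule card_mono)
      show "finite (Z B)"
        using finR by (simp add: Z_def Q_def)
      show "(\<lambda>D. D \<union> \<pi> ` B) ` N \<subseteq> Z B"
      proof (rule image_subsetI)
        fix D assume "D \<in> N"
        then obtain A where D: "D \<subseteq> V" "card D = s" and A: "A \<in> Y B" "(A - B) \<inter> D = {}"
          by (auto simp: N_def C_def)
        have "card (D \<union> \<pi> ` B) = s + card B"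
          using D piB finB finA(3)
          by (subst card_Un_disjoint) (auto simp: V_def intro: finite_subset)
        then have R: "D \<union> \<pi> ` B \<in> R"
          using D piB A1 True by (auto simp: R_def V_def s_def)
        have *: "(D \<union> \<pi> ` B) \<inter> A2 = {}" "(D \<union> \<pi> ` B) \<inter> A1 = \<pi> ` B"
          using D piB by (auto simp: V_def)
        have "\<pi> ` B \<noteq> {}"
          using B by (auto simp: J_def)
        have AX: "A \<in> X" "A \<inter> A1 = {}"
          using A(1) by (auto simp: Y_def P_def)
        have "A \<inter> (D \<union> \<pi> ` B) = {}"
          using AX(2) A(2) D(1) piB(1) BA unfolding V_def by blast
        then have "D \<union> \<pi> ` B \<notin> X"
          using cross[of A "D \<union> \<pi> ` B"] AX * by blast
        then show "D \<union> \<pi> ` B \<in> Z B"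
          using R * \<open>\<pi> ` B \<noteq> {}\<close> by (auto simp: Z_def Q_def)
      qed
    qed
    finally show ?thesis .
  qed
  have "X \<inter> P \<subseteq> (\<Union>B\<in>J. Y B)"
  proof
    fix A assume A: "A \<in> X \<inter> P"
    \<comment> \<open>By \<open>hit\<close> the trace on \<open>A2\<close> is nonempty, hence an
      index in \<open>J\<close>.\<close>
    then have "A \<inter> A1 = {}" "A \<inter> A2 \<noteq> {}"
      using hit by (auto simp: P_def)
    then have "A \<inter> A2 \<in> J" "A \<in> Y (A \<inter> A2)"
      using A by (auto simp: Y_def J_def)
    then show "A \<in> (\<Union>B\<in>J. Y B)"
      by blast
  qed
  then have "card (X \<inter> P) \<le> card (\<Union>B\<in>J. Y B)"
    using finJ finR by (intro card_mono) (auto simp: Y_def P_def)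
  also have "\<dots> \<le> (\<Sum>B\<in>J. card (Y B))"
    using finJ by (rule card_UN_le)
  also have "\<dots> \<le> (\<Sum>B\<in>J. card (Z B))"
    using YZ by (rule sum_mono)
  also have "\<dots> = card (\<Union>B\<in>J. Z B)"
    using finJ finR inj_img
    by (intro card_UN_disjoint[symmetric]) (auto simp: Z_def Q_def dest: inj_img)
  also have "\<dots> \<le> card (Q - X)"
    using finR by (intro card_mono) (auto simp: Z_def Q_def)
  finally have PQ: "card (X \<inter> P) \<le> card (Q - X)" .
  have "P = {A. A \<subseteq> W - A1 \<and> card A = r}"
    by (auto simp: P_def R_def)
  then have "(card W - r) choose r = card P"
    using A1 assms(1) finA by (simp add: n_subsets card_Diff_subset)
  also have "\<dots> = card (P - X) + card (X \<inter> P)"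
    using finR by (subst card_Diff_subset_Int) (auto simp: P_def Int_commute card_mono)
  also have "\<dots> \<le> card (P - X) + card (Q - X)"
    using PQ by simp
  also have "\<dots> = card ((P - X) \<union> (Q - X))"
    using finR by (intro card_Un_disjoint[symmetric]) (auto simp: P_def Q_def)
  also have "\<dots> \<le> card {A. A \<subseteq> W \<and> card A = r \<and> A \<notin> X}"
    using assms(1) by (intro card_mono) (auto simp: P_def Q_def R_def intro: finite_subset[of _ "Pow W"])
  finally show ?thesis .
qed

section \<open>Estimates for binomial coefficients\<close>

lemma real_binomial_ratio:
  "real (Suc s) * real (N choose Suc s) = (real N - real s) * real (N choose s)" if "s \<le> N"
proof -
  have "Suc s * (N choose Suc s) = (N choose s) * (N - s)"
    using binomial_absorb_comp[of N s] binomial_absorption[of s N]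
    by (metis (no_types, lifting) mult.commute)
  then have "real (Suc s) * real (N choose Suc s) = real (N choose s) * real (N - s)"
    by (metis of_nat_mult)
  with that show ?thesis by (simp add: of_nat_diff mult.commute)
qed

text \<open>Going down from the top term, the terms decrease at least as fast as a geometric series
  with ratio \<open>s / (N - s + 1)\<close>, whose sum gives the factor
  \<open>(N - s + 1) / (N - 2 * s + 1)\<close>.\<close>

lemma sum_binomial_le:
  assumes "2 * s \<le> N"
  shows "(real N - 2 * real s + 1) * (\<Sum>i\<le>s. real (N choose i))
    \<le> (real N - real s + 1) * real (N choose s)"
  using assms
proof (induction s)
  case 0
  then show ?case by simp
next
  case (Suc s)
  define S where "S = (\<Sum>i\<le>s. real (N choose i))"
  define x where "x = real N"
  define y where "y = real s"
  define c where "c = real (N choose s)"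
  define c' where "c' = real (N choose Suc s)"
  have xy: "2 * y + 2 \<le> x" "0 \<le> y" "0 \<le> c" using Suc.prems by (auto simp: x_def y_def c_def)
  have IH: "(x - 2 * y + 1) * S \<le> (x - y + 1) * c"
    using Suc by (simp add: S_def x_def y_def c_def)
  have rec: "(y + 1) * c' = (x - y) * c"
    using real_binomial_ratio[of s N] Suc.prems
    by (simp add: x_def y_def c_def c'_def add.commute)
  have "(x - 2 * y + 1) * ((x - 2 * y - 1) * S) = (x - 2 * y - 1) * ((x - 2 * y + 1) * S)"
    by simp
  also have "\<dots> \<le> (x - 2 * y - 1) * ((x - y + 1) * c)"
    using xy IH by (intro mult_left_mono) auto
  also have "\<dots> = ((x - 2 * y - 1) * (x - y + 1)) * c"
    by simp
  \<comment> \<open>The two sides differ by \<open>(x + 1) * c\<close>.\<close>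
  also have "\<dots> \<le> ((x - 2 * y + 1) * (x - y)) * c"
    using xy by (intro mult_right_mono) (auto simp: algebra_simps)
  also have "\<dots> = (x - 2 * y + 1) * ((y + 1) * c')"
    using rec by simp
  finally have "(x - 2 * y - 1) * S \<le> (y + 1) * c'"
    using xy by simp
  then have "(x - 2 * y - 1) * (S + c') \<le> (x - y) * c'"
    by (simp add: algebra_simps)
  then show ?case
    by (simp add: S_def x_def y_def c'_def algebra_simps)
qed

text \<open>The quotient of the two coefficients is a product of \<open>s\<close> factors
  \<open>1 + d / (a - i)\<close>, of which the one for \<open>i = s - 1\<close> is the largest and
  at most \<open>1 + v\<close>.\<close>

lemma binomial_add_le_power:
  fixes v :: real
  assumes "real d \<le> v * (real a - real s + 1)" and "s \<le> a"
  shows "real ((a + d) choose s) \<le> (1 + v) ^ s * real (a choose s)"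
  using assms
proof (induction s)
  case 0
  then show ?case by simp
next
  case (Suc s)
  have pos: "real a - real s > 0"
    using Suc.prems by simp
  have "v \<ge> 0"
  proof (rule ccontr)
    assume "\<not> v \<ge> 0"
    then have "v * (real a - real s) < 0" using pos by (simp add: mult_less_0_iff)
    moreover have "0 \<le> real d" by simp
    ultimately show False using Suc.prems(1) by simp
  qed
  then have "real d \<le> v * (real a - real s + 1)"
    using Suc.prems(1) by (simp add: algebra_simps)
  then have IH: "real ((a + d) choose s) \<le> (1 + v) ^ s * real (a choose s)"
    using Suc by simp
  have "real (Suc s) * real ((a + d) choose Suc s)
      = (real a + real d - real s) * real ((a + d) choose s)"
    using real_binomial_ratio[of s "a + d"] Suc.prems by simp
  also have "\<dots> \<le> ((1 + v) * (real a - real s)) * ((1 + v) ^ s * real (a choose s))"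
    using IH pos Suc.prems(1) \<open>v \<ge> 0\<close> by (intro mult_mono) (auto simp: algebra_simps)
  also have "\<dots> = (1 + v) ^ Suc s * ((real a - real s) * real (a choose s))"
    by simp
  also have "\<dots> = (1 + v) ^ Suc s * (real (Suc s) * real (a choose Suc s))"
    using real_binomial_ratio[of s a] Suc.prems by simp
  also have "\<dots> = real (Suc s) * ((1 + v) ^ Suc s * real (a choose Suc s))"
    by (simp only: ac_simps)
  finally show ?case
    by (subst (asm) mult_le_cancel_left_pos) auto
qed

text \<open>After taking logarithms this is \<open>ln y + 3 / y \<ge> 2\<close> from the outline
  with its lower-order terms, where \<open>p / (r * t)\<close> takes the place of \<open>y\<close>.
  The alternative \<open>r = 1 \<or> 2 \<le> r\<close> is what is kept of the integrality of
  \<open>r\<close>.\<close>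

lemma exp_le_threshold:
  fixes r t :: real
  assumes "1 \<le> r" and "1 \<le> t" and "r = 1 \<or> 2 \<le> r"
  shows "t * exp ((r - 1) * (t + 2 * r) / (r^2 + 2 * r * t - t)) \<le> (r^2 + 2 * r * t - t) / r"
proof -
  define p where "p = r^2 + 2 * r * t - t"
  define w where "w = (r - 1) * (t + 2 * r) / p"
  have rt: "t \<le> r * t" "r \<le> r * r" using assms by auto
  have p: "p > 0" unfolding p_def power2_eq_square using rt assms by linarith
  have ln_ge: "ln (p / (r * t)) \<ge> ln c + 1 - c * (r * t) / p" if "c > 0" for c
  proof -
    have "ln (c * (r * t) / p) \<le> c * (r * t) / p - 1"
      using that p assms by (intro ln_le_minus_one) auto
    moreover have "ln (c * (r * t) / p) = ln c - ln (p / (r * t))"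
      using that p assms by (simp add: ln_div ln_mult)
    ultimately show ?thesis by simp
  qed
  have "w \<le> ln (p / (r * t))"
  proof (cases "t \<le> 2 * r")
    \<comment> \<open>\<open>ln_ge\<close> is the tangent at \<open>p / (r * t) = c\<close>; for \<open>t \<le> 2 * r\<close> take the minimum \<open>c = 3\<close>, for small \<open>r / t\<close> the limit \<open>c = 2\<close>\<close>
    case True
    have "3 * (r * t) + (r - 1) * (t + 2 * r) \<le> 2 * p"
      using True by (simp add: p_def power2_eq_square algebra_simps)
    then have "3 * (r * t) / p + w \<le> 2"
      using p by (simp add: w_def field_simps)
    moreover have "ln (3::real) \<ge> 1"
      using exp_le by (simp add: ln_ge_iff)
    ultimately show ?thesis
      using ln_ge[of 3] by simp
  next
    case False
    show ?thesis
    proof (cases "r = 1")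
      case True
      then show ?thesis using assms by (simp add: w_def p_def)
    next
      case False
      then have r: "r \<ge> 2" using assms by simp
      have "(r - 2) * (2 * r) \<le> (r - 2) * t"
        using r \<open>\<not> t \<le> 2 * r\<close> by (intro mult_left_mono) auto
      moreover have "0 \<le> r * (r + 2)"
        using r by simp
      ultimately have "r * r + t * 2 \<le> r * t + r * 6"
        unfolding left_diff_distrib distrib_left by linarith
      \<comment> \<open>The target \<open>5 / 3\<close> is \<open>1 + 2 / 3\<close>, with
        \<open>2 / 3\<close> the available lower bound for \<open>ln 2\<close>.\<close>
      then have "3 * (2 * (r * t) + (r - 1) * (t + 2 * r)) \<le> 5 * p"
        by (simp add: p_def power2_eq_square algebra_simps)
      then have "2 * (r * t) / p + w \<le> 5 / 3"
        using p by (simp add: w_def field_simps)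
      then show ?thesis
        using ln_ge[of 2] ln2_ge_two_thirds by simp
    qed
  qed
  then have "exp w \<le> p / (r * t)"
    using p assms by (simp add: ln_ge_iff)
  then show ?thesis
    using assms unfolding w_def p_def by (simp add: field_simps)
qed

text \<open>The sum is reduced to its top term, the top term is compared with
  \<open>a choose (r - 1)\<close> for \<open>a = n - t - 2 * r - 1\<close>, and absorption turns
  this into \<open>Suc a choose r\<close>. The exponential factor lost on the way is covered by
  \<open>exp_le_threshold\<close>.\<close>

lemma sum_binomial_le_binomial:
  fixes n r t :: nat
  assumes "r > 0" and "t > 0" and n: "r * (r + 2 * t + 3) \<le> n"
  shows "t * (\<Sum>i<r. (n - 1) choose i) \<le> (n - t - 2 * r) choose r"
proof -
  obtain s where s: "r = Suc s" using assms(1) by (cases r) auto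
  define x y u where "x = real n" and "y = real r" and "u = real t"
  \<comment> \<open>The bound on \<open>n\<close> reads \<open>p + u + 3 * y \<le> x\<close>, so
    \<open>p + 1\<close> is a lower bound for \<open>a - s + 1\<close>. This makes \<open>v\<close>
    admissible in \<open>binomial_add_le_power\<close> for the shift
    \<open>u + 2 * y\<close>.\<close>
  define p where "p = y^2 + 2 * y * u - u"
  define v where "v = (u + 2 * y) / (p + 1)"
  have y: "y \<ge> 1" "y = 1 \<or> y \<ge> 2" and u: "u \<ge> 1"
    using assms by (auto simp: y_def u_def)
  have yu: "u \<le> y * u" "y \<le> y * y" using y u by auto
  have p: "p > 0" unfolding p_def power2_eq_square using yu y u by linarith
  have "real (r * (r + 2 * t + 3)) \<le> real n"
    using n by (rule of_nat_mono)
  then have x: "p + u + 3 * y \<le> x"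
    by (simp add: p_def x_def y_def u_def power2_eq_square algebra_simps)
  then have nge: "t + 3 * r + 1 \<le> n"
    using p unfolding x_def y_def u_def by linarith
  define a where "a = n - t - 2 * r - 1"
  have a: "n - t - 2 * r = Suc a" "n - 1 = a + (t + 2 * r)" "real a = x - u - 2 * y - 1"
    using nge by (auto simp: a_def x_def y_def u_def)
  have sy: "real s = y - 1" using s by (simp add: y_def)
  have v0: "v \<ge> 0" using p y u by (simp add: v_def)
  have "v * (p + 1) \<le> v * (real a - real s + 1)"
    using v0 x a sy by (intro mult_left_mono) auto
  moreover have "v * (p + 1) = u + 2 * y"
    using p by (simp add: v_def)
  ultimately have "real ((n - 1) choose s) \<le> (1 + v) ^ s * real (a choose s)"
    unfolding a(2) using nge s a(1) by (intro binomial_add_le_power) (auto simp: u_def y_def)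
  also have "\<dots> \<le> exp v ^ s * real (a choose s)"
    using v0 by (intro mult_right_mono power_mono) auto
  also have "exp v ^ s = exp ((y - 1) * v)"
    using sy by (simp add: exp_of_nat_mult[symmetric])
  also have "\<dots> \<le> exp ((y - 1) * (u + 2 * y) / p)"
    using p y u by (auto simp: v_def intro!: divide_left_mono)
  finally have "real ((n - 1) choose s) \<le> exp ((y - 1) * (u + 2 * y) / p) * real (a choose s)"
    by (simp add: mult_right_mono)
  then have "u * real ((n - 1) choose s) \<le> u * exp ((y - 1) * (u + 2 * y) / p) * real (a choose s)"
    using u by (simp add: mult.assoc)
  also have "\<dots> \<le> (p / y) * real (a choose s)"
    using exp_le_threshold[of y u] y u by (intro mult_right_mono) (auto simp: p_def)
  finally have 1: "u * real ((n - 1) choose s) \<le> (p / y) * real (a choose s)" .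
  define T where "T = (\<Sum>i<r. real ((n - 1) choose i))"
  have "2 * s \<le> n - 1" using nge s by simp
  from sum_binomial_le[OF this] have 2: "(x - 2 * y + 2) * T \<le> (x - y + 1) * real ((n - 1) choose s)"
    using nge by (simp add: T_def s lessThan_Suc_atMost x_def y_def of_nat_diff algebra_simps)
  have "(x - 2 * y + 2) * (u * T) = u * ((x - 2 * y + 2) * T)"
    by simp
  also have "\<dots> \<le> u * ((x - y + 1) * real ((n - 1) choose s))"
    using u 2 by (intro mult_left_mono) auto
  also have "\<dots> = (x - y + 1) * (u * real ((n - 1) choose s))"
    by simp
  also have "\<dots> \<le> (x - y + 1) * ((p / y) * real (a choose s))"
    using 1 x p u y by (intro mult_left_mono) auto
  also have "\<dots> = ((x - y + 1) * p) * (real (a choose s) / y)"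
    by simp
  also have "\<dots> \<le> ((x - 2 * y + 2) * (x - u - 2 * y)) * (real (a choose s) / y)"
  proof (rule mult_right_mono)
    \<comment> \<open>Since \<open>x - u - 2 * y\<close> is at least \<open>p + y\<close>, the spare
      \<open>y\<close> pays for the factor lost in passing from the sum to its top term.\<close>
    have "(y - 1) * p \<le> y * (x - 2 * y + 2)"
      using x p y u by (intro mult_mono) auto
    then have "(x - y + 1) * p \<le> (x - 2 * y + 2) * (p + y)"
      by (simp add: algebra_simps)
    also have "\<dots> \<le> (x - 2 * y + 2) * (x - u - 2 * y)"
      using x p y u by (intro mult_left_mono) auto
    finally show "(x - y + 1) * p \<le> (x - 2 * y + 2) * (x - u - 2 * y)" .
  qed (use y in auto)
  also have "\<dots> = (x - 2 * y + 2) * real (Suc a choose r)"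
  proof -
    have "real (Suc s) * real (Suc a choose Suc s) = real (Suc a) * real (a choose s)"
      by (metis Suc_times_binomial_eq of_nat_mult mult.commute)
    then have "y * real (Suc a choose r) = (x - u - 2 * y) * real (a choose s)"
      using a(3) s by (simp add: y_def)
    then have "real (Suc a choose r) = (x - u - 2 * y) * real (a choose s) / y"
      using y by (simp add: nonzero_eq_divide_eq mult.commute)
    then show ?thesis by simp
  qed
  finally have "u * T \<le> real (Suc a choose r)"
    using x p y u by (subst (asm) mult_le_cancel_left_pos) auto
  then have "real (t * (\<Sum>i<r. (n - 1) choose i)) \<le> real (Suc a choose r)"
    by (simp add: u_def T_def)
  then show ?thesis
    unfolding a(1) by (simp only: of_nat_le_iff)
qed

text \<open>Pascal's rule applied \<open>t\<close> times produces \<open>t\<close> terms, each at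
  most the last one, \<open>(m + t - 1) choose i\<close>.\<close>

lemma binomial_add_le:
  "(m + t) choose Suc i \<le> (m choose Suc i) + t * ((m + t - 1) choose i)"
proof (induction t)
  case 0
  then show ?case by simp
next
  case (Suc t)
  have "(m + t - 1) choose i \<le> (m + t) choose i"
    by (rule binomial_right_mono) simp
  then have "t * ((m + t - 1) choose i) \<le> t * ((m + t) choose i)"
    by (rule mult_le_mono2)
  moreover have "(m + Suc t) choose Suc i = ((m + t) choose i) + ((m + t) choose Suc i)"
    by simp
  moreover have "Suc t * ((m + Suc t - 1) choose i) = ((m + t) choose i) + t * ((m + t) choose i)"
    by simp
  ultimately show ?case
    using Suc.IH by linarith
qed

text \<open>With \<open>m = n - t\<close> the last term bounds how far the number of all sets of
  size at most \<open>r\<close> exceeds the claimed bound; so many non-differences have to be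
  found.\<close>

lemma sum_binomial_add_le:
  "(\<Sum>i\<le>r. (m + t) choose i) \<le> (\<Sum>i\<le>r. m choose i) + t * (\<Sum>i<r. (m + t - 1) choose i)"
proof (induction r)
  case 0
  then show ?case by simp
next
  case (Suc r)
  then show ?case
    using binomial_add_le[of m t r] by (simp add: distrib_left)
qed

section \<open>Sets contained in no member of a \<open>t\<close>-intersecting family\<close>

text \<open>Only subsets of \<open>W = V - H\<close> are counted. Whether there are several classes
  or one, at least \<open>(card W - r) choose r\<close> of them lie in no member.\<close>

lemma card_not_in_shadow_ge:
  assumes "finite V" and \<F>: "\<F> \<subseteq> {A. A \<subseteq> V \<and> card A = k}"
    and int: "t_intersecting t \<F>" and "t < k" and "H \<in> \<F>"
    and star: "\<And>T. card T = t \<Longrightarrow> \<exists>G\<in>\<F>. \<not> T \<subseteq> G"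
    and V: "4 * (k - t) \<le> card V - k"
  shows "(card V - k - (k - t)) choose (k - t)
    \<le> card {A. A \<subseteq> V \<and> card A = k - t \<and> \<not> (\<exists>F\<in>\<F>. A \<subseteq> F)}" (is "_ \<le> card ?N")
proof -
  define r where "r = k - t"
  define W where "W = V - H"
  define X where "X = {A. A \<subseteq> W \<and> card A = r \<and> (\<exists>F\<in>\<F>. A \<subseteq> F)}"
  have H: "H \<subseteq> V" "card H = k" "finite H"
    using \<F> \<open>H \<in> \<F>\<close> finite_subset[OF _ \<open>finite V\<close>] by auto
  have W: "finite W" "card W = card V - k"
    using \<open>finite V\<close> H by (auto simp: W_def card_Diff_subset)
  have finN: "finite ?N"
    using \<open>finite V\<close> by simp
  have inter: "t \<le> card (F \<inter> G)" if "F \<in> \<F>" "G \<in> \<F>" for F G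
    using int that by (auto simp: t_intersecting_def)
  have "\<exists>S. S \<subseteq> H \<and> card S = t \<and> A \<union> S \<in> \<F>" if A: "A \<in> X" for A
  proof -
    obtain F where F: "F \<in> \<F>" "A \<subseteq> F" and A': "A \<inter> H = {}" "card A = r"
      using A by (auto simp: X_def W_def)
    have finF: "finite F" "card F = k"
      using F \<F> finite_subset[OF _ \<open>finite V\<close>] by auto
    have "card (F - A) = t"
      using F finF A' \<open>t < k\<close> by (simp add: card_Diff_subset finite_subset r_def)
    moreover have "F \<inter> H \<subseteq> F - A"
      using A' by blast
    ultimately have "F \<inter> H = F - A"
      using inter[OF F(1) \<open>H \<in> \<F>\<close>] finF by (intro card_seteq) auto
    with \<open>card (F - A) = t\<close> F show ?thesis
      by (intro exI[of _ "F - A"]) (auto simp: Un_absorb1)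
  qed
  \<comment> \<open>A set may lie in several members, so \<open>\<sigma>\<close> chooses one class
    for each set.\<close>
  then obtain \<sigma> where \<sigma>: "\<And>A. A \<in> X \<Longrightarrow> \<sigma> A \<subseteq> H \<and> card (\<sigma> A) = t \<and> A \<union> \<sigma> A \<in> \<F>"
    by metis
  have \<sigma>_eq: "\<sigma> A = \<sigma> B" if "A \<in> X" "B \<in> X" "A \<inter> B = {}" for A B
  proof -
    have "(A \<union> \<sigma> A) \<inter> (B \<union> \<sigma> B) = \<sigma> A \<inter> \<sigma> B"
      using that \<sigma>[OF that(1)] \<sigma>[OF that(2)] by (auto simp: X_def W_def)
    then have "t \<le> card (\<sigma> A \<inter> \<sigma> B)"
      using inter[of "A \<union> \<sigma> A" "B \<union> \<sigma> B"] \<sigma> that by simp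
    moreover have "finite (\<sigma> A)" "finite (\<sigma> B)" "card (\<sigma> A) = t" "card (\<sigma> B) = t"
      using \<sigma> that H(3) by (auto dest: finite_subset)
    ultimately have "\<sigma> A \<inter> \<sigma> B = \<sigma> A" "\<sigma> A \<inter> \<sigma> B = \<sigma> B"
      by (simp_all add: card_seteq)
    then show ?thesis by simp
  qed
  have XN: "{A. A \<subseteq> W \<and> card A = r \<and> A \<notin> X} \<subseteq> ?N"
    by (auto simp: X_def W_def r_def)
  show ?thesis
  proof (cases "\<exists>A1\<in>X. \<exists>A2\<in>X. \<sigma> A1 \<noteq> \<sigma> A2")
    case True
    then obtain A1 A2 where A: "A1 \<in> X" "A2 \<in> X" "\<sigma> A1 \<noteq> \<sigma> A2"
      by blast
    have "(card W - r) choose r \<le> card {A. A \<subseteq> W \<and> card A = r \<and> A \<notin> X}"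
    proof (rule card_not_in_cross_intersecting_ge[where ?A1.0 = A1 and ?A2.0 = A2])
      show "4 * r \<le> card W" "0 < r"
        using V W \<open>t < k\<close> by (auto simp: r_def)
      show "A1 \<subseteq> W" "card A1 = r" "A2 \<subseteq> W" "card A2 = r"
        using A by (auto simp: X_def)
      \<comment> \<open>A set missing both \<open>A1\<close> and \<open>A2\<close> would inherit two
        different classes. For the cross condition, \<open>B\<close> has the class of
        \<open>A1\<close> and \<open>C\<close> that of \<open>A2\<close>, so they cannot be
        disjoint.\<close>
      show "B \<inter> A2 \<noteq> {}" if "B \<in> X" "B \<inter> A1 = {}" for B
        using \<sigma>_eq[of B A1] \<sigma>_eq[of B A2] that A by auto
      show "B \<inter> C \<noteq> {}" if "B \<in> X" "C \<in> X" "B \<inter> A1 = {}" "C \<inter> A2 = {}" for B C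
        using \<sigma>_eq[of B A1] \<sigma>_eq[of C A2] \<sigma>_eq[of B C] that A by auto
    qed (rule W)
    also have "\<dots> \<le> card ?N"
      using finN XN by (rule card_mono)
    finally show ?thesis
      using W by (simp add: r_def)
  next
    case False
    have "\<exists>T. card T = t \<and> (\<forall>A\<in>X. \<sigma> A = T)"
    proof (cases "X = {}")
      \<comment> \<open>Without any class an arbitrary \<open>t\<close>-set serves as
        \<open>T\<close>.\<close>
      case True
      then show ?thesis
        using obtain_subset_with_card_n[of t H] H \<open>t < k\<close> by auto
    next
      case nonempty: False
      then show ?thesis
        using False \<sigma> by blast
    qed
    then obtain T where T: "card T = t" "\<And>A. A \<in> X \<Longrightarrow> \<sigma> A = T"
      by blast
    obtain G where G: "G \<in> \<F>" "\<not> T \<subseteq> G"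
      using star T(1) by blast
    have finG: "finite G" "card G = k"
      using G(1) \<F> finite_subset[OF _ \<open>finite V\<close>] by auto
    have "{A. A \<subseteq> W - G \<and> card A = r} \<subseteq> {A. A \<subseteq> W \<and> card A = r \<and> A \<notin> X}"
    proof clarify
      fix A assume A: "A \<subseteq> W - G"
      have "A \<notin> X"
      proof
        assume "A \<in> X"
        then have AT: "A \<union> T \<in> \<F>" "T \<subseteq> H"
          using T \<sigma> by auto
        have "(A \<union> T) \<inter> G = T \<inter> G"
          using A by blast
        moreover have "card (T \<inter> G) < card T"
          using G AT H by (intro psubset_card_mono) (auto intro: finite_subset)
        ultimately show False
          using inter[OF AT(1) G(1)] T(1) by simp
      qed
      then show "A \<subseteq> W \<and> card A = card A \<and> A \<notin> X"
        using A by blast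
    qed
    then have "card {A. A \<subseteq> W - G \<and> card A = r} \<le> card ?N"
      using XN finN by (intro card_mono) auto
    moreover have "card {A. A \<subseteq> W - G \<and> card A = r} = card (W - G) choose r"
      using W by (simp add: n_subsets)
    \<comment> \<open>\<open>G\<close> meets \<open>H\<close> in at least \<open>t\<close> points,
      so it removes at most \<open>r\<close> points from \<open>W\<close>; this gives the same bound
      as the case of two classes.\<close>
    moreover have "card W - r \<le> card (W - G)"
    proof -
      have "card (G - H) = k - card (G \<inter> H)"
        using finG by (simp add: card_Diff_subset_Int)
      then have "card (G - H) \<le> r"
        using inter[OF G(1) \<open>H \<in> \<F>\<close>] by (simp add: r_def)
      moreover have "W - G = W - (G - H)"
        by (auto simp: W_def)
      moreover have "card W - card (G - H) \<le> card (W - (G - H))"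
        using finG by (intro diff_card_le_card_Diff) auto
      ultimately show ?thesis by simp
    qed
    ultimately show ?thesis
      using W binomial_right_mono[of "card W - r" "card (W - G)" r] by (simp add: r_def)
  qed
qed

section \<open>The bound on the number of differences\<close>

lemma card_subsets_card_le:
  assumes "finite V"
  shows "card {A. A \<subseteq> V \<and> card A \<le> r} = (\<Sum>i\<le>r. card V choose i)"
proof -
  have "{A. A \<subseteq> V \<and> card A \<le> r} = (\<Union>i\<le>r. {A. A \<subseteq> V \<and> card A = i})"
    by auto
  then show ?thesis
    using assms by (simp only:) (subst card_UN_disjoint, auto simp: n_subsets)
qed

theorem theorem4:
  fixes n k t :: nat and \<F> :: "nat set set"
  assumes "n > 0" and "k > 0" and "t > 0" and "k \<ge> t"
    and "\<F> \<subseteq> {A. A \<subseteq> {1..n} \<and> card A = k}"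
    and "t_intersecting t \<F>"
    and "int n \<ge> int ((k - t) * (k + t + 3))
                   * \<lfloor>(real (k + t + 3) / real (k + t + 1)) ^ (t - 1)\<rfloor>"
  shows "card (set_differences \<F>) \<le> (\<Sum>i = 0..k - t. (n - t) choose i)"
proof -
  define r where "r = k - t"
  have k: "k = r + t"
    using assms(4) by (simp add: r_def)
  have mem: "F \<subseteq> {1..n}" "card F = k" "finite F" if "F \<in> \<F>" for F
    using assms(5) that finite_subset[of F "{1..n}"] by auto
  have inter: "t \<le> card (F \<inter> G)" if "F \<in> \<F>" "G \<in> \<F>" for F G
    using assms(6) that by (auto simp: t_intersecting_def)
  have card_diff: "card (F - G) \<le> r" if "F \<in> \<F>" "G \<in> \<F>" for F G
    using inter[OF that] mem[OF that(1)] by (simp add: card_Diff_subset_Int r_def)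
  have sub: "set_differences \<F> \<subseteq> {A. A \<subseteq> {1..n} \<and> card A \<le> r}"
    using mem card_diff by (auto simp: set_differences_def)
  show ?thesis
  proof (cases "\<F> \<noteq> {} \<longrightarrow> (\<exists>T. card T = t \<and> (\<forall>F\<in>\<F>. T \<subseteq> F))")
    case True
    show ?thesis
    proof (cases "\<F> = {}")
      case True
      then show ?thesis by (simp add: set_differences_def)
    next
      case False
      then obtain T H where T: "card T = t" "\<forall>F\<in>\<F>. T \<subseteq> F" and H: "H \<in> \<F>"
        using True by blast
      then have T': "T \<subseteq> {1..n}" "finite T"
        using mem[OF H] by (auto intro: finite_subset)
      have "set_differences \<F> \<subseteq> {A. A \<subseteq> {1..n} - T \<and> card A \<le> r}"
      proof
        fix A assume "A \<in> set_differences \<F>"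
        then obtain F G where "A = F - G" "F \<in> \<F>" "G \<in> \<F>"
          by (auto simp: set_differences_def)
        moreover from this have "A \<inter> T = {}"
          using T(2) by blast
        ultimately show "A \<in> {A. A \<subseteq> {1..n} - T \<and> card A \<le> r}"
          using mem(1) card_diff by blast
      qed
      then have "card (set_differences \<F>) \<le> card {A. A \<subseteq> {1..n} - T \<and> card A \<le> r}"
        by (intro card_mono) auto
      also have "\<dots> = (\<Sum>i\<le>r. (n - t) choose i)"
        using T T' by (subst card_subsets_card_le) (auto simp: card_Diff_subset)
      finally show ?thesis
        by (simp add: r_def atMost_atLeast0)
    qed
  next
    case False
    then obtain H where H: "H \<in> \<F>"
      and star: "\<And>T. card T = t \<Longrightarrow> \<exists>G\<in>\<F>. \<not> T \<subseteq> G"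
      by blast
    \<comment> \<open>For \<open>r = 0\<close> the member \<open>H\<close> would itself be a common
      \<open>t\<close>-set.\<close>
    have "r > 0"
    proof (rule ccontr)
      assume "\<not> r > 0"
      then have "card H = t"
        using mem[OF H] k by simp
      then obtain G where G: "G \<in> \<F>" "\<not> H \<subseteq> G"
        using star by blast
      then have "card (H - G) > 0"
        using mem[OF H] by (auto simp: card_gt_0_iff)
      then show False
        using card_diff[OF H G(1)] \<open>\<not> r > 0\<close> by simp
    qed
    have "1 \<le> (real (k + t + 3) / real (k + t + 1)) ^ (t - 1)"
      by (intro one_le_power) (simp add: field_simps)
    then have "1 \<le> \<lfloor>(real (k + t + 3) / real (k + t + 1)) ^ (t - 1)\<rfloor>"
      by (simp only: one_le_floor)
    then have "int ((k - t) * (k + t + 3)) * 1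
        \<le> int ((k - t) * (k + t + 3)) * \<lfloor>(real (k + t + 3) / real (k + t + 1)) ^ (t - 1)\<rfloor>"
      by (intro mult_left_mono) auto
    with assms(7) have "(k - t) * (k + t + 3) \<le> n"
      by linarith
    then have n: "r * (r + 2 * t + 3) \<le> n"
      by (simp add: k algebra_simps)
    \<comment> \<open>This is \<open>(r - 1) * (t - 1) \<ge> 0\<close>, and \<open>r2\<close> is
      \<open>(r - 1)^2 \<ge> 0\<close>; they make the quadratic bound on \<open>n\<close>
      linear.\<close>
    have rt: "t + r \<le> Suc (r * t)"
      using \<open>r > 0\<close> \<open>t > 0\<close> by (cases r; cases t) auto
    have r2: "2 * r \<le> Suc (r * r)"
      using \<open>r > 0\<close> by (cases r) auto
    have "r * r + 2 * (r * t) + 3 * r \<le> n"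
      using n by (simp add: algebra_simps)
    then have "5 * r + t \<le> n"
      using rt r2 \<open>r > 0\<close> assms(3) by linarith
    then have nk: "4 * r \<le> n - k" "t \<le> n"
      by (auto simp: k)
    define N where "N = {A. A \<subseteq> {1..n} \<and> card A = r \<and> \<not> (\<exists>F\<in>\<F>. A \<subseteq> F)}"
    have "(card {1..n} - k - (k - t)) choose (k - t) \<le> card N"
      unfolding N_def r_def
      by (rule card_not_in_shadow_ge[OF _ assms(5,6) _ H star]) (use nk \<open>r > 0\<close> in \<open>auto simp: r_def\<close>)
    moreover have "card {1..n} - k - (k - t) = n - t - 2 * r" "k - t = r"
      by (auto simp: k)
    ultimately have "(n - t - 2 * r) choose r \<le> card N"
      by simp
    moreover have "t * (\<Sum>i<r. (n - 1) choose i) \<le> (n - t - 2 * r) choose r"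
      using \<open>r > 0\<close> assms(3) n by (rule sum_binomial_le_binomial)
    \<comment> \<open>Every difference lies in a member and no set of \<open>N\<close> does, so both
      families fit side by side among the sets of size at most \<open>r\<close>.\<close>
    moreover have "card (set_differences \<F>) + card N \<le> (\<Sum>i\<le>r. n choose i)"
    proof -
      have fin: "finite {A. A \<subseteq> {1..n} \<and> card A \<le> r}"
        by simp
      have "set_differences \<F> \<inter> N = {}"
        by (auto simp: set_differences_def N_def)
      moreover have "finite (set_differences \<F>)" "finite N"
        using finite_subset[OF sub fin] by (simp_all add: N_def)
      ultimately have "card (set_differences \<F>) + card N = card (set_differences \<F> \<union> N)"
        by (simp add: card_Un_disjoint)
      also have "\<dots> \<le> card {A. A \<subseteq> {1..n} \<and> card A \<le> r}"
        using fin sub by (intro card_mono) (auto simp: N_def)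
      also have "\<dots> = (\<Sum>i\<le>r. n choose i)"
        by (simp add: card_subsets_card_le)
      finally show ?thesis .
    qed
    moreover have "(\<Sum>i\<le>r. n choose i) \<le> (\<Sum>i\<le>r. (n - t) choose i) + t * (\<Sum>i<r. (n - 1) choose i)"
      using sum_binomial_add_le[of "n - t" t r] nk(2) by simp
    ultimately show ?thesis
      by (simp add: r_def atMost_atLeast0)
  qed
qed

end
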